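(* Let $E,F,G$ be Riesz spaces. Then the following hold. (1) If $T\in L_{so}(E,F)$ and $S\in L_n(F,G)$, then $ST\in L_{so}(E,G)$. As a consequence, $L_{so}(E)$ is a left ideal for $L_n(E)$. Similarly, $L_{s\sigma o}(E)$ is a left ideal for $L_c(E)$. (2) If $E$ is $\sigma$-Dedekind complete and $\sigma$-laterally complete, $S\in L_c(E,F)$ and $T\in L_{s\sigma o}(F,G)$, then $TS\in L_{s\sigma o}(E,G)$. In this case (that is, when $E$ is $\sigma$-Dedekind complete and $\sigma$-laterally complete), $L_{s\sigma o}(E,F)=L_c(E,F)$.
   Context: Riesz spaces are real vector lattices; operators are linear. A net $(x_\alpha)_{\alpha\in\mathcal A}$ in a Riesz space $E$ is order convergent to $x\in E$, written $x_\alpha\xrightarrow{o}x$, if there is a net $(y_\beta)_{\beta\in\mathcal B}$ in $E$ (possibly with a different index set) such that $y_\beta\downarrow 0$ and for every $\beta\in\mathcal B$ there exists $\alpha_0\in\mathcal A$ with $|x_\alpha-x|\le y_\beta$ for all $\alpha\ge\alpha_0$. The net is unbounded order convergent to $x$, written $x_\alpha\xrightarrow{uo}x$, if $|x_\alpha-x|\wedge u\xrightarrow{o}0$ for all $u\in E^+$. The same definitions apply to sequences, regarded as nets. An operator $T:E\to F$ between Riesz spaces is: strongly order continuous ($so$-continuous) if $x_\alpha\xrightarrow{uo}0$ in $E$ implies $Tx_\alpha\xrightarrow{o}0$ in $F$ for every net $(x_\alpha)$; strongly $\sigma$-order continuous ($s\sigma o$-continuous) if $x_n\xrightarrow{uo}0$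 in $E$ implies $Tx_n\xrightarrow{o}0$ in $F$ for every sequence $(x_n)$; order continuous if $x_\alpha\xrightarrow{o}0$ implies $Tx_\alpha\xrightarrow{o}0$ for every net; $\sigma$-order continuous if $x_n\xrightarrow{o}0$ implies $Tx_n\xrightarrow{o}0$ for every sequence. $L_b(E,F)$ denotes the space of order bounded operators from $E$ to $F$. $L_{so}(E,F)$, $L_{s\sigma o}(E,F)$, $L_n(E,F)$ and $L_c(E,F)$ denote the sets of those $T\in L_b(E,F)$ that are, respectively, $so$-continuous, $s\sigma o$-continuous, order continuous and $\sigma$-order continuous. $L_{so}(E)$ means $L_{so}(E,E)$, and similarly for $L_{s\sigma o}(E)$, $L_n(E)$, $L_c(E)$; "left ideal" refers to multiplication given by composition of operators. A Riesz space is $\sigma$-Dedekind complete if every nonempty countable subset that is bounded above has a supremum; it is $\sigma$-laterally complete if every disjoint sequence has a supremum. *)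

theory Defs
  imports Complex_Main "HOL-Library.Lattice_Algebras" "HOL-Library.Lub_Glb"
    "HOL-Library.Countable_Set"
begin

class riesz_space = ordered_real_vector + lattice_ab_group_add_abs

text \<open>A net is a function on a carrier \<open>A\<close> that is directed by a relation \<open>r\<close>, where
  \<open>(a, b) \<in> r\<close> means \<open>a \<le> b\<close>.\<close>

definition directed_set :: "'i set \<Rightarrow> 'i rel \<Rightarrow> bool" where
  "directed_set A r \<longleftrightarrow>
     A \<noteq> {} \<and> preorder_on A r \<and> (\<forall>a\<in>A. \<forall>b\<in>A. \<exists>c\<in>A. (a, c) \<in> r \<and> (b, c) \<in> r)"

definition decreases_to_zero :: "'i set \<Rightarrow> 'i rel \<Rightarrow> ('i \<Rightarrow> 'a::riesz_space) \<Rightarrow> bool" where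
  "decreases_to_zero B s y \<longleftrightarrow>
     (\<forall>b\<in>B. \<forall>b'\<in>B. (b, b') \<in> s \<longrightarrow> y b' \<le> y b) \<and> isGlb UNIV (y ` B) 0"

text \<open>HOL cannot quantify over types inside a definition, so the index set of the dominating net
  is taken to be a subset of the space itself. This is no restriction, see
  \<open>order_convergentI\<close>.\<close>

definition order_convergent :: "'i set \<Rightarrow> 'i rel \<Rightarrow> ('i \<Rightarrow> 'a::riesz_space) \<Rightarrow> 'a \<Rightarrow> bool" where
  "order_convergent A r x l \<longleftrightarrow>
     (\<exists>(B :: 'a set) s y. directed_set B s \<and> decreases_to_zero B s y \<and>
        (\<forall>b\<in>B. \<exists>a0\<in>A. \<forall>a\<in>A. (a0, a) \<in> r \<longrightarrow> \<bar>x a - l\<bar> \<le> y b))"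

definition uo_convergent :: "'i set \<Rightarrow> 'i rel \<Rightarrow> ('i \<Rightarrow> 'a::riesz_space) \<Rightarrow> 'a \<Rightarrow> bool" where
  "uo_convergent A r x l \<longleftrightarrow>
     (\<forall>u\<ge>0. order_convergent A r (\<lambda>a. inf \<bar>x a - l\<bar> u) 0)"

abbreviation nat_le :: "nat rel" where
  "nat_le \<equiv> {(m, n). m \<le> n}"

lemma directed_set_nat_le: "directed_set UNIV nat_le"
  unfolding directed_set_def preorder_on_def refl_on_def trans_def
  by (auto intro: max.cobounded1 max.cobounded2)

lemma order_convergentI:
  fixes y :: "'j \<Rightarrow> 'a::riesz_space"
  assumes B: "directed_set B s" and y: "decreases_to_zero B s y"
    and dom: "\<forall>b\<in>B. \<exists>a0\<in>A. \<forall>a\<in>A. (a0, a) \<in> r \<longrightarrow> \<bar>x a - l\<bar> \<le> y b"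
  shows "order_convergent A r x l"
proof -
  define s' where "s' = {(u, v). u \<in> y ` B \<and> v \<in> y ` B \<and> v \<le> u}"
  have "\<exists>w\<in>y ` B. (u, w) \<in> s' \<and> (v, w) \<in> s'" if uv: "u \<in> y ` B" "v \<in> y ` B" for u v
  proof -
    from uv obtain a b where ab: "a \<in> B" "b \<in> B" "u = y a" "v = y b" by blast
    with B obtain c where "c \<in> B" "(a, c) \<in> s" "(b, c) \<in> s"
      unfolding directed_set_def by blast
    with ab y show ?thesis unfolding s'_def decreases_to_zero_def by blast
  qed
  moreover have "preorder_on (y ` B) s'"
    unfolding preorder_on_def refl_on_def trans_def s'_def by auto
  ultimately have "directed_set (y ` B) s'"
    using B unfolding directed_set_def by blast
  moreover have "decreases_to_zero (y ` B) s' id"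
    using y unfolding decreases_to_zero_def s'_def by auto
  moreover have "\<forall>b\<in>y ` B. \<exists>a0\<in>A. \<forall>a\<in>A. (a0, a) \<in> r \<longrightarrow> \<bar>x a - l\<bar> \<le> id b"
    using dom by simp
  ultimately show ?thesis unfolding order_convergent_def by blast
qed

text \<open>For the same reason the nets below are indexed by subsets of \<open>'a set \<times> 'a\<close>, with \<open>'a\<close> the
  domain. This type is large enough: every net in the domain, over any index type, has the same
  eventual behaviour as one of these (indexed by its tails together with a point of the tail). See
  \<open>so_continuous_net\<close> and \<open>order_continuous_net\<close>.\<close>

definition so_continuous :: "('a::riesz_space \<Rightarrow> 'b::riesz_space) \<Rightarrow> bool" where
  "so_continuous T \<longleftrightarrow>
     (\<forall>(A :: ('a set \<times> 'a) set) r x. directed_set A r \<longrightarrow>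
        uo_convergent A r x 0 \<longrightarrow> order_convergent A r (\<lambda>a. T (x a)) 0)"

definition order_continuous :: "('a::riesz_space \<Rightarrow> 'b::riesz_space) \<Rightarrow> bool" where
  "order_continuous T \<longleftrightarrow>
     (\<forall>(A :: ('a set \<times> 'a) set) r x. directed_set A r \<longrightarrow>
        order_convergent A r x 0 \<longrightarrow> order_convergent A r (\<lambda>a. T (x a)) 0)"

definition s_sigma_o_continuous :: "('a::riesz_space \<Rightarrow> 'b::riesz_space) \<Rightarrow> bool" where
  "s_sigma_o_continuous T \<longleftrightarrow>
     (\<forall>x. uo_convergent UNIV nat_le x 0 \<longrightarrow> order_convergent UNIV nat_le (\<lambda>n. T (x n)) 0)"

definition sigma_order_continuous :: "('a::riesz_space \<Rightarrow> 'b::riesz_space) \<Rightarrow> bool" where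
  "sigma_order_continuous T \<longleftrightarrow>
     (\<forall>x. order_convergent UNIV nat_le x 0 \<longrightarrow> order_convergent UNIV nat_le (\<lambda>n. T (x n)) 0)"

definition tail :: "'i set \<Rightarrow> 'i rel \<Rightarrow> ('i \<Rightarrow> 'a) \<Rightarrow> 'i \<Rightarrow> 'a set" where
  "tail A r x a = x ` {b \<in> A. (a, b) \<in> r}"

definition tail_index :: "'i set \<Rightarrow> 'i rel \<Rightarrow> ('i \<Rightarrow> 'a) \<Rightarrow> ('a set \<times> 'a) set" where
  "tail_index A r x = {(S, p). (\<exists>a\<in>A. S = tail A r x a) \<and> p \<in> S}"

definition tail_rel :: "'i set \<Rightarrow> 'i rel \<Rightarrow> ('i \<Rightarrow> 'a) \<Rightarrow> ('a set \<times> 'a) rel" where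
  "tail_rel A r x = {(i, j). i \<in> tail_index A r x \<and> j \<in> tail_index A r x \<and> fst j \<subseteq> fst i}"

lemma tail_self: "directed_set A r \<Longrightarrow> a \<in> A \<Longrightarrow> x a \<in> tail A r x a"
  unfolding directed_set_def preorder_on_def refl_on_def tail_def by blast

lemma tail_mono:
  assumes "directed_set A r" "(a, b) \<in> r"
  shows "tail A r x b \<subseteq> tail A r x a"
  using assms unfolding directed_set_def preorder_on_def tail_def by (blast dest: transD)

lemma directed_set_tail:
  assumes A: "directed_set A r"
  shows "directed_set (tail_index A r x) (tail_rel A r x)"
proof -
  have "\<exists>k\<in>tail_index A r x. (i, k) \<in> tail_rel A r x \<and> (j, k) \<in> tail_rel A r x"
    if ij: "i \<in> tail_index A r x" "j \<in> tail_index A r x" for i j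
  proof -
    from ij obtain a b where ab: "a \<in> A" "fst i = tail A r x a" "b \<in> A" "fst j = tail A r x b"
      unfolding tail_index_def by auto
    with A obtain c where c: "c \<in> A" "(a, c) \<in> r" "(b, c) \<in> r"
      unfolding directed_set_def by blast
    then have "(tail A r x c, x c) \<in> tail_index A r x"
      using tail_self[OF A] unfolding tail_index_def by blast
    moreover have "tail A r x c \<subseteq> fst i" "tail A r x c \<subseteq> fst j"
      using ab c tail_mono[OF A] by simp_all
    ultimately show ?thesis
      using ij by (intro bexI[of _ "(tail A r x c, x c)"]) (auto simp: tail_rel_def)
  qed
  moreover have "preorder_on (tail_index A r x) (tail_rel A r x)"
    unfolding preorder_on_def refl_on_def trans_def tail_rel_def by auto
  moreover have "tail_index A r x \<noteq> {}"
  proof -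
    obtain a where "a \<in> A" using A unfolding directed_set_def by blast
    then have "(tail A r x a, x a) \<in> tail_index A r x"
      using tail_self[OF A] unfolding tail_index_def by blast
    then show ?thesis by blast
  qed
  ultimately show ?thesis unfolding directed_set_def by blast
qed

lemma eventually_tail_iff:
  assumes A: "directed_set A r"
  shows "(\<exists>i0\<in>tail_index A r x. \<forall>i\<in>tail_index A r x. (i0, i) \<in> tail_rel A r x \<longrightarrow> P (snd i)) \<longleftrightarrow>
         (\<exists>a0\<in>A. \<forall>a\<in>A. (a0, a) \<in> r \<longrightarrow> P (x a))" (is "?L \<longleftrightarrow> ?R")
proof
  assume ?L
  then obtain i0 where i0: "i0 \<in> tail_index A r x"
    "\<And>i. i \<in> tail_index A r x \<Longrightarrow> (i0, i) \<in> tail_rel A r x \<Longrightarrow> P (snd i)" by blast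
  then obtain a0 where a0: "a0 \<in> A" "fst i0 = tail A r x a0"
    unfolding tail_index_def by auto
  have "P (x a)" if "a \<in> A" "(a0, a) \<in> r" for a
  proof -
    have m: "(tail A r x a, x a) \<in> tail_index A r x"
      using that tail_self[OF A] unfolding tail_index_def by blast
    moreover have "(i0, (tail A r x a, x a)) \<in> tail_rel A r x"
      using m i0(1) a0 tail_mono[OF A that(2)] unfolding tail_rel_def by simp
    ultimately show ?thesis using i0(2) by fastforce
  qed
  with a0 show ?R by blast
next
  assume ?R
  then obtain a0 where a0: "a0 \<in> A" "\<And>a. a \<in> A \<Longrightarrow> (a0, a) \<in> r \<Longrightarrow> P (x a)" by blast
  have "(tail A r x a0, x a0) \<in> tail_index A r x"
    using a0(1) tail_self[OF A] unfolding tail_index_def by blast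
  moreover have "P (snd i)" if "((tail A r x a0, x a0), i) \<in> tail_rel A r x" for i
  proof -
    have "snd i \<in> tail A r x a0"
      using that unfolding tail_rel_def tail_index_def by auto
    then show ?thesis using a0(2) unfolding tail_def by auto
  qed
  ultimately show ?L by blast
qed

lemma order_convergent_tail_iff:
  assumes "directed_set A r"
  shows "order_convergent (tail_index A r x) (tail_rel A r x) (\<lambda>i. f (snd i)) l \<longleftrightarrow>
         order_convergent A r (\<lambda>a. f (x a)) l"
  unfolding order_convergent_def eventually_tail_iff[OF assms, where P = "\<lambda>e. \<bar>f e - l\<bar> \<le> _"] ..

lemma uo_convergent_tail_iff:
  assumes "directed_set A r"
  shows "uo_convergent (tail_index A r x) (tail_rel A r x) snd l \<longleftrightarrow> uo_convergent A r x l"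
  unfolding uo_convergent_def
  using order_convergent_tail_iff[OF assms, where f = "\<lambda>e. inf \<bar>e - l\<bar> _"] by simp

lemma so_continuous_net:
  fixes x :: "'i \<Rightarrow> 'a::riesz_space"
  assumes "so_continuous T" "directed_set A r" "uo_convergent A r x 0"
  shows "order_convergent A r (\<lambda>a. T (x a)) 0"
proof -
  have "uo_convergent (tail_index A r x) (tail_rel A r x) snd 0"
    using uo_convergent_tail_iff[OF assms(2)] assms(3) by blast
  then have "order_convergent (tail_index A r x) (tail_rel A r x) (\<lambda>i. T (snd i)) 0"
    using assms(1) directed_set_tail[OF assms(2), where x = x] unfolding so_continuous_def by blast
  then show ?thesis
    using order_convergent_tail_iff[OF assms(2), where x = x and f = T] by simp
qed

lemma order_continuous_net:
  fixes x :: "'i \<Rightarrow> 'a::riesz_space"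
  assumes "order_continuous T" "directed_set A r" "order_convergent A r x 0"
  shows "order_convergent A r (\<lambda>a. T (x a)) 0"
proof -
  have "order_convergent (tail_index A r x) (tail_rel A r x) snd 0"
    using order_convergent_tail_iff[OF assms(2), where x = x and f = "\<lambda>e. e"] assms(3) by simp
  then have "order_convergent (tail_index A r x) (tail_rel A r x) (\<lambda>i. T (snd i)) 0"
    using assms(1) directed_set_tail[OF assms(2), where x = x] unfolding order_continuous_def by blast
  then show ?thesis
    using order_convergent_tail_iff[OF assms(2), where x = x and f = T] by simp
qed

definition L_b :: "('a::riesz_space \<Rightarrow> 'b::riesz_space) set" where
  "L_b = {T. linear T \<and> (\<forall>a b. \<exists>c d. T ` {a..b} \<subseteq> {c..d})}"

definition L_so :: "('a::riesz_space \<Rightarrow> 'b::riesz_space) set" where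
  "L_so = {T \<in> L_b. so_continuous T}"

definition L_s_sigma_o :: "('a::riesz_space \<Rightarrow> 'b::riesz_space) set" where
  "L_s_sigma_o = {T \<in> L_b. s_sigma_o_continuous T}"

definition L_n :: "('a::riesz_space \<Rightarrow> 'b::riesz_space) set" where
  "L_n = {T \<in> L_b. order_continuous T}"

definition L_c :: "('a::riesz_space \<Rightarrow> 'b::riesz_space) set" where
  "L_c = {T \<in> L_b. sigma_order_continuous T}"

definition sigma_dedekind_complete :: "'a::riesz_space itself \<Rightarrow> bool" where
  "sigma_dedekind_complete _ \<longleftrightarrow>
     (\<forall>S :: 'a set. S \<noteq> {} \<longrightarrow> countable S \<longrightarrow> bdd_above S \<longrightarrow> (\<exists>s. isLub UNIV S s))"

definition sigma_laterally_complete :: "'a::riesz_space itself \<Rightarrow> bool" where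
  "sigma_laterally_complete _ \<longleftrightarrow>
     (\<forall>x :: nat \<Rightarrow> 'a. (\<forall>m n. m \<noteq> n \<longrightarrow> inf \<bar>x m\<bar> \<bar>x n\<bar> = 0) \<longrightarrow> (\<exists>s. isLub UNIV (range x) s))"

definition operator_subspace :: "('a::real_vector \<Rightarrow> 'b::real_vector) set \<Rightarrow> bool" where
  "operator_subspace V \<longleftrightarrow> V \<subseteq> Collect linear \<and> (\<lambda>_. 0) \<in> V \<and>
     (\<forall>S\<in>V. \<forall>T\<in>V. (\<lambda>x. S x + T x) \<in> V) \<and> (\<forall>c. \<forall>T\<in>V. (\<lambda>x. c *\<^sub>R T x) \<in> V)"

definition operator_algebra :: "('a::real_vector \<Rightarrow> 'a) set \<Rightarrow> bool" where
  "operator_algebra A \<longleftrightarrow> operator_subspace A \<and> (\<forall>S\<in>A. \<forall>T\<in>A. S \<circ> T \<in> A)"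

definition left_ideal :: "('a::real_vector \<Rightarrow> 'a) set \<Rightarrow> ('a \<Rightarrow> 'a) set \<Rightarrow> bool" where
  "left_ideal I A \<longleftrightarrow> operator_algebra A \<and> operator_subspace I \<and> I \<subseteq> A \<and>
     (\<forall>S\<in>A. \<forall>T\<in>I. S \<circ> T \<in> I)"

end

theory Submission
  imports Defs
begin

text \<open>Order convergence implies unbounded order convergence, because
  \<open>\<bar>x\<bar> \<and> u \<le> \<bar>x\<bar>\<close>. Hence an operator that turns \<open>uo\<close>-null nets into order null nets
  is order continuous, and following it by an order continuous operator keeps that property. The
  ideal statements add to this that sums and multiples of order null nets are order null.

  The real content is that in a \<open>\<sigma>\<close>-Dedekind complete and \<open>\<sigma>\<close>-laterally complete space
  every \<open>uo\<close>-null sequence is order null (\<open>uo_null_imp_order_null\<close>). It is enough to find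
  an upper bound \<open>u\<close> of all \<open>\<bar>x n\<bar>\<close> (\<open>uo_null_bounded\<close>), since then
  \<open>\<bar>x n\<bar> = \<bar>x n\<bar> \<and> u\<close>. In a space of measurable functions the bound is
  constructed pointwise: a sequence that tends to zero at almost every point is bounded at almost
  every point, and the pointwise bounds glue together along a countable partition. Without points,
  the partition is made by band projections. For an increasing sequence \<open>p n\<close> of positive
  elements, the slice of \<open>v\<close> with index \<open>n\<close> is its part in the band of \<open>p (n + 1)\<close> that is
  disjoint from \<open>p n\<close>. Slices with different indices are disjoint, so lateral completeness
  bounds any choice of one slice per index (\<open>slices_bounded\<close>); conversely, if \<open>d\<close> bounds all
  slices of \<open>v\<close>, then \<open>v\<close> exceeds \<open>d\<close> only away from all \<open>p n\<close>
  (\<open>excess_disjoint\<close>).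

  The construction is used twice. Slicing along the partial sums of \<open>\<bar>x n\<bar>\<close> gives an element
  \<open>e\<close> whose support covers that of every \<open>x n\<close> (\<open>common_support\<close>). Slicing along
  \<open>p (N + 1) = e - sup {\<bar>x n\<bar> \<and> e | n \<ge> N}\<close> works because on the support of
  \<open>p (N + 1)\<close> all \<open>\<bar>x n\<bar>\<close> with \<open>n \<ge> N\<close> stay below \<open>e\<close>: there, only finitely
  many of the excesses \<open>(\<bar>x n\<bar> - e)\<^sup>+\<close> are nonzero. Since \<open>x\<close> is \<open>uo\<close>-null,
  these elements increase to \<open>e\<close>, so nothing is left outside their supports.\<close>

section \<open>Order null nets\<close>

lemma order_convergent_dominated:
  assumes "order_convergent A r x 0" "\<And>a. a \<in> A \<Longrightarrow> \<bar>z a\<bar> \<le> \<bar>x a\<bar>"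
  shows "order_convergent A r z 0"
  using assms unfolding order_convergent_def by simp (meson order_trans)

lemma order_convergent_imp_uo_convergent:
  fixes x :: "'i \<Rightarrow> 'a::riesz_space"
  assumes "order_convergent A r x 0"
  shows "uo_convergent A r x 0"
  unfolding uo_convergent_def
proof (intro allI impI)
  fix u :: 'a assume "0 \<le> u"
  then show "order_convergent A r (\<lambda>a. inf \<bar>x a - 0\<bar> u) 0"
    by (intro order_convergent_dominated[OF assms]) (simp add: abs_of_nonneg)
qed

lemma decreases_to_zero_iff:
  "decreases_to_zero B s y \<longleftrightarrow>
     (\<forall>b\<in>B. \<forall>b'\<in>B. (b, b') \<in> s \<longrightarrow> y b' \<le> y b) \<and> (\<forall>b\<in>B. 0 \<le> y b) \<and>
     (\<forall>t. (\<forall>b\<in>B. t \<le> y b) \<longrightarrow> t \<le> 0)"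
  unfolding decreases_to_zero_def isGlb_def greatestP_def isLb_def setle_def setge_def
  by (auto simp: Ball_def)

lemma isLub_UNIV_iff:
  "isLub UNIV S s \<longleftrightarrow> (\<forall>x\<in>S. x \<le> s) \<and> (\<forall>t. (\<forall>x\<in>S. x \<le> t) \<longrightarrow> s \<le> t)"
  unfolding isLub_def leastP_def isUb_def setle_def setge_def by auto

text \<open>The sum of the two dominating nets, indexed by the product of their index sets, has infimum
  zero: a lower bound \<open>u\<close> satisfies \<open>u - y b \<le> w c\<close> for all \<open>c\<close>, hence
  \<open>u \<le> y b\<close> for all \<open>b\<close>.\<close>

lemma order_convergent_add:
  fixes x z :: "'i \<Rightarrow> 'a::riesz_space"
  assumes A: "directed_set A r"
    and x: "order_convergent A r x 0" and z: "order_convergent A r z 0"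
  shows "order_convergent A r (\<lambda>a. x a + z a) 0"
proof -
  obtain B s y where B: "directed_set (B :: 'a set) s" and y: "decreases_to_zero B s y"
    and xy: "\<And>b. b \<in> B \<Longrightarrow> \<exists>a0\<in>A. \<forall>a\<in>A. (a0, a) \<in> r \<longrightarrow> \<bar>x a\<bar> \<le> y b"
    using x unfolding order_convergent_def by auto
  obtain C t w where C: "directed_set (C :: 'a set) t" and w: "decreases_to_zero C t w"
    and zw: "\<And>c. c \<in> C \<Longrightarrow> \<exists>a0\<in>A. \<forall>a\<in>A. (a0, a) \<in> r \<longrightarrow> \<bar>z a\<bar> \<le> w c"
    using z unfolding order_convergent_def by auto
  define q where "q = {((b, c), (b', c')). (b, b') \<in> s \<and> (c, c') \<in> t}"
  have "preorder_on (B \<times> C) q"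
    using B C unfolding directed_set_def preorder_on_def refl_on_def trans_def q_def by blast
  moreover have "\<exists>k\<in>B \<times> C. (i, k) \<in> q \<and> (j, k) \<in> q" if ij: "i \<in> B \<times> C" "j \<in> B \<times> C" for i j
  proof -
    have m: "fst i \<in> B" "fst j \<in> B" "snd i \<in> C" "snd j \<in> C" using ij by auto
    obtain b where "b \<in> B" "(fst i, b) \<in> s" "(fst j, b) \<in> s"
      using B m unfolding directed_set_def by blast
    moreover obtain c where "c \<in> C" "(snd i, c) \<in> t" "(snd j, c) \<in> t"
      using C m unfolding directed_set_def by blast
    ultimately show ?thesis
      unfolding q_def by (intro bexI[of _ "(b, c)"]) (auto simp: split_beta)
  qed
  ultimately have q: "directed_set (B \<times> C) q"
    using B C unfolding directed_set_def by auto
  show ?thesis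
  proof (rule order_convergentI[OF q])
    have "u \<le> 0" if u: "\<forall>p\<in>B \<times> C. u \<le> y (fst p) + w (snd p)" for u
    proof -
      have "u - y b \<le> 0" if b: "b \<in> B" for b
      proof -
        have "\<forall>c\<in>C. u - y b \<le> w c" using u b by (auto simp: algebra_simps)
        then show ?thesis using w unfolding decreases_to_zero_iff by blast
      qed
      then have "\<forall>b\<in>B. u \<le> y b" by simp
      then show ?thesis using y unfolding decreases_to_zero_iff by blast
    qed
    then show "decreases_to_zero (B \<times> C) q (\<lambda>p. y (fst p) + w (snd p))"
      using y w unfolding decreases_to_zero_iff q_def by (auto intro: add_mono)
    show "\<forall>p\<in>B \<times> C. \<exists>a0\<in>A. \<forall>a\<in>A. (a0, a) \<in> r \<longrightarrow> \<bar>x a + z a - 0\<bar> \<le> y (fst p) + w (snd p)"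
    proof
      fix p assume p: "p \<in> B \<times> C"
      have pm: "fst p \<in> B" "snd p \<in> C" using p by auto
      obtain a1 where a1: "a1 \<in> A" "\<forall>a\<in>A. (a1, a) \<in> r \<longrightarrow> \<bar>x a\<bar> \<le> y (fst p)"
        using xy[OF pm(1)] by blast
      obtain a2 where a2: "a2 \<in> A" "\<forall>a\<in>A. (a2, a) \<in> r \<longrightarrow> \<bar>z a\<bar> \<le> w (snd p)"
        using zw[OF pm(2)] by blast
      obtain a0 where a0: "a0 \<in> A" "(a1, a0) \<in> r" "(a2, a0) \<in> r"
        using A a1(1) a2(1) unfolding directed_set_def by blast
      have "\<bar>x a + z a\<bar> \<le> y (fst p) + w (snd p)" if a: "a \<in> A" "(a0, a) \<in> r" for a
      proof -
        have "(a1, a) \<in> r" "(a2, a) \<in> r"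
          using A a0 a unfolding directed_set_def preorder_on_def by (meson transD)+
        then have "\<bar>x a\<bar> + \<bar>z a\<bar> \<le> y (fst p) + w (snd p)"
          using a1 a2 a by (intro add_mono) auto
        then show ?thesis using abs_triangle_ineq order_trans by blast
      qed
      with a0 show "\<exists>a0\<in>A. \<forall>a\<in>A. (a0, a) \<in> r \<longrightarrow> \<bar>x a + z a - 0\<bar> \<le> y (fst p) + w (snd p)"
        by auto
    qed
  qed
qed

lemma order_convergent_zero:
  assumes A: "directed_set A r"
  shows "order_convergent A r (\<lambda>_. 0 :: 'a::riesz_space) 0"
proof (rule order_convergentI)
  show "directed_set (UNIV :: unit set) UNIV"
    unfolding directed_set_def preorder_on_def by (auto simp: refl_on_def trans_def)
  show "decreases_to_zero (UNIV :: unit set) UNIV (\<lambda>_. 0 :: 'a)"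
    unfolding decreases_to_zero_iff by auto
  show "\<forall>b\<in>(UNIV :: unit set). \<exists>a0\<in>A. \<forall>a\<in>A. (a0, a) \<in> r \<longrightarrow> \<bar>0 - 0 :: 'a\<bar> \<le> 0"
    using A unfolding directed_set_def by auto
qed

lemma abs_scaleR_le:
  fixes v :: "'a::riesz_space"
  shows "\<bar>c *\<^sub>R v\<bar> \<le> \<bar>c\<bar> *\<^sub>R \<bar>v\<bar>"
proof -
  have le: "\<bar>c\<bar> *\<^sub>R v \<le> \<bar>c\<bar> *\<^sub>R \<bar>v\<bar>" "\<bar>c\<bar> *\<^sub>R (- v) \<le> \<bar>c\<bar> *\<^sub>R \<bar>v\<bar>"
    by (intro scaleR_left_mono abs_ge_self abs_ge_minus_self abs_ge_zero)+
  then show ?thesis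
    by (intro abs_leI) (cases "c \<ge> 0"; simp)+
qed

lemma order_convergent_scaleR:
  fixes x :: "'i \<Rightarrow> 'a::riesz_space"
  assumes A: "directed_set A r" and x: "order_convergent A r x 0"
  shows "order_convergent A r (\<lambda>a. c *\<^sub>R x a) 0"
proof (cases "c = 0")
  case True
  then show ?thesis using order_convergent_zero[OF A] by simp
next
  case False
  obtain B s y where B: "directed_set (B :: 'a set) s" and y: "decreases_to_zero B s y"
    and xy: "\<And>b. b \<in> B \<Longrightarrow> \<exists>a0\<in>A. \<forall>a\<in>A. (a0, a) \<in> r \<longrightarrow> \<bar>x a\<bar> \<le> y b"
    using x unfolding order_convergent_def by auto
  show ?thesis
  proof (rule order_convergentI[OF B])
    have "t \<le> 0" if t: "\<forall>b\<in>B. t \<le> \<bar>c\<bar> *\<^sub>R y b" for t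
    proof -
      have "\<forall>b\<in>B. t /\<^sub>R \<bar>c\<bar> \<le> y b"
        using t False scaleR_left_mono[of t _ "inverse \<bar>c\<bar>"] by fastforce
      then have "t /\<^sub>R \<bar>c\<bar> \<le> 0" using y unfolding decreases_to_zero_iff by blast
      from scaleR_left_mono[OF this, of "\<bar>c\<bar>"] show ?thesis using False by simp
    qed
    then show "decreases_to_zero B s (\<lambda>b. \<bar>c\<bar> *\<^sub>R y b)"
      using y unfolding decreases_to_zero_iff
      by (auto intro: scaleR_left_mono scaleR_nonneg_nonneg)
    have "\<bar>c *\<^sub>R x a - 0\<bar> \<le> \<bar>c\<bar> *\<^sub>R y b" if "\<bar>x a\<bar> \<le> y b" for a b
      using abs_scaleR_le[of c "x a"] scaleR_left_mono[OF that, of "\<bar>c\<bar>"] by simp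
    then show "\<forall>b\<in>B. \<exists>a0\<in>A. \<forall>a\<in>A. (a0, a) \<in> r \<longrightarrow> \<bar>c *\<^sub>R x a - 0\<bar> \<le> \<bar>c\<bar> *\<^sub>R y b"
      using xy by meson
  qed
qed

section \<open>Spaces of operators and their products\<close>

lemma L_b_comp:
  assumes "T \<in> L_b" "S \<in> L_b"
  shows "S \<circ> T \<in> L_b"
proof -
  have "\<exists>c d. (S \<circ> T) ` {a..b} \<subseteq> {c..d}" for a b
  proof -
    obtain c d where "T ` {a..b} \<subseteq> {c..d}" using assms(1) unfolding L_b_def by blast
    moreover obtain c' d' where "S ` {c..d} \<subseteq> {c'..d'}" using assms(2) unfolding L_b_def by blast
    ultimately have "(S \<circ> T) ` {a..b} \<subseteq> {c'..d'}" by fastforce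
    then show ?thesis by blast
  qed
  then show ?thesis using assms unfolding L_b_def by (simp add: linear_compose)
qed

lemma operator_subspace_L_b:
  "operator_subspace (L_b :: ('a::riesz_space \<Rightarrow> 'b::riesz_space) set)"
proof -
  have add: "\<exists>c d. (\<lambda>x. S x + T x) ` {a..b} \<subseteq> {c..d}"
    if ST: "\<forall>a b. \<exists>c d. S ` {a..b} \<subseteq> {c..d}" "\<forall>a b. \<exists>c d. T ` {a..b} \<subseteq> {c..d}"
    for S T :: "'a \<Rightarrow> 'b" and a b
  proof -
    obtain c d c' d' where "S ` {a..b} \<subseteq> {c..d}" "T ` {a..b} \<subseteq> {c'..d'}" using ST by metis
    then have "(\<lambda>x. S x + T x) ` {a..b} \<subseteq> {c + c'..d + d'}"
      by (force intro: add_mono)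
    then show ?thesis by blast
  qed
  have scale: "\<exists>c d. (\<lambda>x. k *\<^sub>R T x) ` {a..b} \<subseteq> {c..d}"
    if T: "\<forall>a b. \<exists>c d. T ` {a..b} \<subseteq> {c..d}" for k and T :: "'a \<Rightarrow> 'b" and a b
  proof -
    obtain c d where cd: "T ` {a..b} \<subseteq> {c..d}" using T by metis
    then have "(\<lambda>x. k *\<^sub>R T x) ` {a..b} \<subseteq> {k *\<^sub>R c..k *\<^sub>R d} \<union> {k *\<^sub>R d..k *\<^sub>R c}"
      by (cases "0 \<le> k") (fastforce intro: scaleR_left_mono scaleR_left_mono_neg)+
    moreover have "\<dots> \<subseteq> {inf (k *\<^sub>R c) (k *\<^sub>R d)..sup (k *\<^sub>R c) (k *\<^sub>R d)}"
      by (auto intro: le_infI1 le_infI2 le_supI1 le_supI2)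
    ultimately show ?thesis by blast
  qed
  have zero: "\<exists>c d. (\<lambda>_. 0 :: 'b) ` {a..b} \<subseteq> {c..d}" for a b :: 'a
    by (intro exI[of _ 0]) auto
  show ?thesis
    unfolding operator_subspace_def
  proof (intro conjI ballI allI)
    show "(L_b :: ('a \<Rightarrow> 'b) set) \<subseteq> Collect linear" unfolding L_b_def by blast
    show "(\<lambda>_. 0) \<in> (L_b :: ('a \<Rightarrow> 'b) set)"
      unfolding L_b_def by (intro CollectI conjI allI zero linear_zero)
    show "(\<lambda>x. S x + T x) \<in> L_b" if "S \<in> L_b" "T \<in> L_b" for S T :: "'a \<Rightarrow> 'b"
      using that add[of S T] unfolding L_b_def by (simp add: linear_compose_add)
    show "(\<lambda>x. c *\<^sub>R T x) \<in> L_b" if "T \<in> L_b" for c and T :: "'a \<Rightarrow> 'b"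
      using that scale[of T c] unfolding L_b_def by (simp add: linear_compose_scale_right)
  qed
qed

text \<open>The four classes of operators are all of this form, with \<open>N\<close> the nets that have to be
  mapped to order null nets; for the sequential classes, \<open>N\<close> also fixes the index set.\<close>

lemma operator_subspace_order_null:
  fixes N :: "'i set \<Rightarrow> 'i rel \<Rightarrow> ('i \<Rightarrow> 'a::riesz_space) \<Rightarrow> bool"
  assumes N: "\<And>A r x. N A r x \<Longrightarrow> directed_set A r"
  shows "operator_subspace
    {T \<in> (L_b :: ('a \<Rightarrow> 'b::riesz_space) set).
      \<forall>A r x. N A r x \<longrightarrow> order_convergent A r (\<lambda>a. T (x a)) 0}" (is "operator_subspace ?V")
proof -
  let ?L = "L_b :: ('a \<Rightarrow> 'b) set"
  have L_b: "?L \<subseteq> Collect linear" "(\<lambda>_. 0) \<in> ?L"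
    "\<And>S T. S \<in> ?L \<Longrightarrow> T \<in> ?L \<Longrightarrow> (\<lambda>x. S x + T x) \<in> ?L"
    "\<And>c T. T \<in> ?L \<Longrightarrow> (\<lambda>x. c *\<^sub>R T x) \<in> ?L"
    using operator_subspace_L_b[where 'a = 'a and 'b = 'b] unfolding operator_subspace_def by blast+
  show ?thesis
    unfolding operator_subspace_def
  proof (intro conjI ballI allI)
    show "?V \<subseteq> Collect linear" using L_b(1) by blast
    show "(\<lambda>_. 0) \<in> ?V" using L_b(2) by (auto intro: order_convergent_zero N)
    show "(\<lambda>x. S x + T x) \<in> ?V" if "S \<in> ?V" "T \<in> ?V" for S T
      using that by (auto intro!: L_b(3) order_convergent_add dest: N)
    show "(\<lambda>x. c *\<^sub>R T x) \<in> ?V" if "T \<in> ?V" for c T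
      using that by (auto intro!: L_b(4) order_convergent_scaleR dest: N)
  qed
qed

lemma operator_subspace_L_so: "operator_subspace L_so"
  unfolding L_so_def so_continuous_def imp_conjL[symmetric]
  by (rule operator_subspace_order_null) blast

lemma operator_subspace_L_n: "operator_subspace L_n"
  unfolding L_n_def order_continuous_def imp_conjL[symmetric]
  by (rule operator_subspace_order_null) blast

lemma operator_subspace_L_s_sigma_o:
  "operator_subspace (L_s_sigma_o :: ('a::riesz_space \<Rightarrow> 'b::riesz_space) set)"
proof -
  have "operator_subspace {T \<in> (L_b :: ('a \<Rightarrow> 'b) set). \<forall>A r x.
      A = UNIV \<and> r = nat_le \<and> uo_convergent A r x 0 \<longrightarrow> order_convergent A r (\<lambda>n. T (x n)) 0}"
    by (rule operator_subspace_order_null) (use directed_set_nat_le in blast)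
  then show ?thesis unfolding L_s_sigma_o_def s_sigma_o_continuous_def by simp
qed

lemma operator_subspace_L_c:
  "operator_subspace (L_c :: ('a::riesz_space \<Rightarrow> 'b::riesz_space) set)"
proof -
  have "operator_subspace {T \<in> (L_b :: ('a \<Rightarrow> 'b) set). \<forall>A r x.
      A = UNIV \<and> r = nat_le \<and> order_convergent A r x 0 \<longrightarrow> order_convergent A r (\<lambda>n. T (x n)) 0}"
    by (rule operator_subspace_order_null) (use directed_set_nat_le in blast)
  then show ?thesis unfolding L_c_def sigma_order_continuous_def by simp
qed

lemma L_so_subset_L_n: "L_so \<subseteq> L_n"
  unfolding L_so_def L_n_def so_continuous_def order_continuous_def
  using order_convergent_imp_uo_convergent by blast

lemma L_s_sigma_o_subset_L_c: "L_s_sigma_o \<subseteq> L_c"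
  unfolding L_s_sigma_o_def L_c_def s_sigma_o_continuous_def sigma_order_continuous_def
  using order_convergent_imp_uo_convergent by blast

text \<open>The image net \<open>T (x a)\<close> lives in the middle space but has an index set built from the
  first one, so the continuity of \<open>S\<close> is needed for an arbitrary index type.\<close>

lemma L_n_comp_L_so:
  fixes T :: "'a::riesz_space \<Rightarrow> 'b::riesz_space"
  assumes S: "S \<in> L_n" and T: "T \<in> L_so" shows "S \<circ> T \<in> L_so"
proof -
  have "so_continuous (S \<circ> T)"
    unfolding so_continuous_def comp_def
  proof (intro allI impI)
    fix A :: "('a set \<times> 'a) set" and r and x :: "'a set \<times> 'a \<Rightarrow> 'a"
    assume A: "directed_set A r" and "uo_convergent A r x 0"
    then have "order_convergent A r (\<lambda>a. T (x a)) 0"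
      using T unfolding L_so_def so_continuous_def by blast
    then show "order_convergent A r (\<lambda>a. S (T (x a))) 0"
      using order_continuous_net[OF _ A] S unfolding L_n_def by blast
  qed
  then show ?thesis using S T L_b_comp unfolding L_n_def L_so_def by blast
qed

lemma L_n_comp:
  fixes T :: "'a::riesz_space \<Rightarrow> 'b::riesz_space"
  assumes S: "S \<in> L_n" and T: "T \<in> L_n" shows "S \<circ> T \<in> L_n"
proof -
  have "order_continuous (S \<circ> T)"
    unfolding order_continuous_def comp_def
  proof (intro allI impI)
    fix A :: "('a set \<times> 'a) set" and r and x :: "'a set \<times> 'a \<Rightarrow> 'a"
    assume A: "directed_set A r" and "order_convergent A r x 0"
    then have "order_convergent A r (\<lambda>a. T (x a)) 0"
      using T unfolding L_n_def order_continuous_def by blast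
    then show "order_convergent A r (\<lambda>a. S (T (x a))) 0"
      using order_continuous_net[OF _ A] S unfolding L_n_def by blast
  qed
  then show ?thesis using S T L_b_comp unfolding L_n_def by blast
qed

lemma L_c_comp_L_s_sigma_o:
  assumes "S \<in> L_c" "T \<in> L_s_sigma_o" shows "S \<circ> T \<in> L_s_sigma_o"
  using assms L_b_comp[of T S]
  unfolding L_c_def L_s_sigma_o_def sigma_order_continuous_def s_sigma_o_continuous_def by auto

lemma L_c_comp:
  assumes "S \<in> L_c" "T \<in> L_c" shows "S \<circ> T \<in> L_c"
  using assms L_b_comp[of T S] unfolding L_c_def sigma_order_continuous_def by auto

section \<open>Disjointness and band projections\<close>

lemma inf_add_le:
  fixes f x y :: "'a::lattice_ab_group_add"
  assumes "0 \<le> f" "0 \<le> x" "0 \<le> y"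
  shows "inf f (x + y) \<le> inf f x + inf f y"
proof -
  have "inf f x + inf f y = inf (inf (f + f) (x + f)) (inf (f + y) (x + y))"
    by (simp add: add_inf_distrib_left add_inf_distrib_right)
  moreover have "inf f (x + y) \<le> f + f" "inf f (x + y) \<le> x + f" "inf f (x + y) \<le> f + y"
    using assms by (auto intro!: le_infI1 simp: add_increasing add_increasing2)
  ultimately show ?thesis by simp
qed

lemma inf_eq_0_mono:
  fixes f x y :: "'a::lattice_ab_group_add"
  assumes "inf f x = 0" "0 \<le> y" "y \<le> x"
  shows "inf f y = 0"
proof (rule antisym)
  show "inf f y \<le> 0" using inf_mono[OF order_refl assms(3), of f] assms(1) by simp
  show "0 \<le> inf f y" using assms by (metis inf.cobounded1 le_infI)
qed

lemma inf_add_eq_0: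
  fixes f x y :: "'a::lattice_ab_group_add"
  assumes "inf f x = 0" "inf f y = 0"
  shows "inf f (x + y) = 0"
proof (rule antisym)
  have nn: "0 \<le> f" "0 \<le> x" "0 \<le> y" using assms by (metis inf.cobounded1 inf.cobounded2)+
  show "inf f (x + y) \<le> 0" using inf_add_le[OF nn] assms by simp
  show "0 \<le> inf f (x + y)" using nn by simp
qed

text \<open>Disjointness passes to suprema. For disjoint elements the sum is the supremum, so
  \<open>x + (f \<and> s) \<le> s\<close> for every \<open>x\<close> in the set; thus \<open>s - (f \<and> s)\<close> is an upper
  bound too, and \<open>f \<and> s\<close> cannot be positive.\<close>

lemma inf_isLub_eq_0:
  fixes f s :: "'a::lattice_ab_group_add"
  assumes s: "isLub UNIV S s" and S: "S \<noteq> {}" and f: "\<And>x. x \<in> S \<Longrightarrow> inf f x = 0"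
  shows "inf f s = 0"
proof (rule antisym)
  have le: "x \<le> s" if "x \<in> S" for x using s that by (auto simp: isLub_UNIV_iff)
  obtain x0 where x0: "x0 \<in> S" using S by blast
  have "0 \<le> x0" "0 \<le> f" using f[OF x0] by (metis inf.cobounded1 inf.cobounded2)+
  with le[OF x0] show nn: "0 \<le> inf f s" by simp
  have "x \<le> s - inf f s" if x: "x \<in> S" for x
  proof -
    have "inf x (inf f s) = 0"
      using f[OF x] le[OF x] by (metis inf.absorb1 inf.commute inf.left_commute inf_sup_aci(2))
    then have "x + inf f s = sup x (inf f s)"
      using add_eq_inf_sup[of x "inf f s"] by simp
    also have "\<dots> \<le> s" using le[OF x] by simp
    finally show ?thesis unfolding le_diff_eq .
  qed
  then have "s \<le> s - inf f s" using s unfolding isLub_UNIV_iff by blast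
  then show "inf f s \<le> 0" by (metis add_le_same_cancel1 le_diff_eq)
qed

lemma isLub_sequence:
  fixes x :: "nat \<Rightarrow> 'a::riesz_space"
  assumes "sigma_dedekind_complete TYPE('a)" "\<And>n. x n \<le> b"
  shows "\<exists>s. isLub UNIV (range x) s"
proof -
  have "countable (range x)" "range x \<noteq> {}" "bdd_above (range x)"
    using assms(2) unfolding bdd_above_def by auto
  then show ?thesis using assms(1) unfolding sigma_dedekind_complete_def by blast
qed

text \<open>The projection of \<open>v\<close> onto the band generated by \<open>a\<close>, by the formula for principal
  bands; it is meaningful for positive arguments.\<close>

definition band_part :: "'a::riesz_space \<Rightarrow> 'a \<Rightarrow> 'a" where
  "band_part a v = (SOME q. isLub UNIV (range (\<lambda>k. inf v (real k *\<^sub>R a))) q)"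

context
  fixes a v :: "'a::riesz_space"
  assumes dc: "sigma_dedekind_complete TYPE('a)" and a: "0 \<le> a" and v: "0 \<le> v"
begin

lemma band_part_isLub: "isLub UNIV (range (\<lambda>k. inf v (real k *\<^sub>R a))) (band_part a v)"
  unfolding band_part_def
  by (rule someI_ex, rule isLub_sequence[OF dc, of _ v]) simp

lemma band_part_le: "band_part a v \<le> v"
  using band_part_isLub unfolding isLub_UNIV_iff by auto

lemma band_part_nonneg: "0 \<le> band_part a v"
proof -
  have "inf v (real 0 *\<^sub>R a) \<le> band_part a v" using band_part_isLub unfolding isLub_UNIV_iff by blast
  then show ?thesis using v by (simp add: inf.absorb2)
qed

text \<open>Together with \<open>inf_diff_band_part_eq_0\<close> below, this characterises the decomposition:
  the band part is disjoint from whatever is disjoint from \<open>a\<close>, the rest is disjoint from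
  \<open>a\<close> itself.\<close>

lemma inf_band_part_eq_0:
  assumes f: "inf f a = 0"
  shows "inf f (band_part a v) = 0"
proof (rule inf_isLub_eq_0[OF band_part_isLub])
  have f0: "0 \<le> f" using f by (metis inf.cobounded1)
  have mult: "inf f (real k *\<^sub>R a) = 0" for k
  proof (induction k)
    case (Suc k)
    then show ?case using inf_add_eq_0[OF f Suc] by (simp add: scaleR_left_distrib)
  qed (use f0 in \<open>simp add: inf.absorb2\<close>)
  have "inf f (inf v (real k *\<^sub>R a)) = 0" for k
    by (rule inf_eq_0_mono[OF mult[of k]]) (use a v in \<open>simp_all add: scaleR_nonneg_nonneg\<close>)
  then show "inf f x = 0" if "x \<in> range (\<lambda>k. inf v (real k *\<^sub>R a))" for x
    using that by blast
qed simp

text \<open>Adding \<open>g = a \<and> (v - band_part a v)\<close> to \<open>v \<and> k a\<close> stays below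
  \<open>v \<and> (k + 1) a\<close>, hence below the supremum; taking the supremum over \<open>k\<close> leaves no room
  for a positive \<open>g\<close>.\<close>

lemma inf_diff_band_part_eq_0: "inf a (v - band_part a v) = 0"
proof (rule antisym)
  define g where "g = inf a (v - band_part a v)"
  show "0 \<le> inf a (v - band_part a v)" using a band_part_le by simp
  have ub: "inf v (real k *\<^sub>R a) \<le> band_part a v" for k
    using band_part_isLub unfolding isLub_UNIV_iff by blast
  have "inf v (real k *\<^sub>R a) \<le> band_part a v - g" for k
  proof -
    have "inf v (real k *\<^sub>R a) + g \<le> band_part a v + (v - band_part a v)"
      unfolding g_def by (intro add_mono ub) simp
    moreover have "inf v (real k *\<^sub>R a) + g \<le> real k *\<^sub>R a + a"
      unfolding g_def by (intro add_mono) simp_all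
    ultimately have "inf v (real k *\<^sub>R a) + g \<le> inf v (real (Suc k) *\<^sub>R a)"
      by (simp add: scaleR_left_distrib add.commute)
    also have "\<dots> \<le> band_part a v" by (rule ub)
    finally show ?thesis by (simp add: algebra_simps)
  qed
  then have "band_part a v \<le> band_part a v - g"
    using band_part_isLub unfolding isLub_UNIV_iff by blast
  then have "g \<le> 0" by simp
  then show "inf a (v - band_part a v) \<le> 0" unfolding g_def .
qed

end

lemma le_of_le_add_disjoint:
  fixes f x y :: "'a::lattice_ab_group_add"
  assumes "f \<le> x + y" "inf f y = 0" "0 \<le> x"
  shows "f \<le> x"
proof -
  have "0 \<le> f" "0 \<le> y" using assms(2) by (metis inf.cobounded1 inf.cobounded2)+
  then have "f \<le> inf f x + inf f y" using inf_add_le[of f x y] assms by (simp add: inf.absorb1)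
  then show ?thesis using assms by simp
qed

section \<open>Slicing along an increasing sequence\<close>

locale increasing_sequence =
  fixes p :: "nat \<Rightarrow> 'a::riesz_space"
  assumes dedekind: "sigma_dedekind_complete TYPE('a)"
    and p_0: "p 0 = 0" and p_mono: "m \<le> n \<Longrightarrow> p m \<le> p n"
begin

definition slice :: "nat \<Rightarrow> 'a \<Rightarrow> 'a" where
  "slice n v = band_part (p (Suc n)) v - band_part (p n) v"

lemma p_nonneg: "0 \<le> p n"
  using p_mono[of 0 n] p_0 by simp

lemma slice_nonneg:
  assumes v: "0 \<le> v"
  shows "0 \<le> slice n v"
proof -
  note bp = dedekind p_nonneg v
  have "inf (v - band_part (p (Suc n)) v) (p n) = 0"
    by (rule inf_eq_0_mono[OF _ p_nonneg p_mono[of n "Suc n"]])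
      (use inf_diff_band_part_eq_0[OF bp] in \<open>simp_all add: inf.commute\<close>)
  then have "inf (v - band_part (p (Suc n)) v) (band_part (p n) v) = 0"
    by (rule inf_band_part_eq_0[OF bp])
  then have "band_part (p n) v \<le> band_part (p (Suc n)) v"
    by (intro le_of_le_add_disjoint[OF _ _ band_part_nonneg[OF bp],
          where y = "v - band_part (p (Suc n)) v"])
      (use band_part_le[OF bp] in \<open>simp_all add: inf.commute\<close>)
  then show ?thesis unfolding slice_def by simp
qed

lemma inf_slice_eq_0:
  assumes v: "0 \<le> v" and f: "inf f (p (Suc n)) = 0"
  shows "inf f (slice n v) = 0"
  using band_part_nonneg[OF dedekind p_nonneg v] slice_nonneg[OF v]
  by (intro inf_eq_0_mono[OF inf_band_part_eq_0[OF dedekind p_nonneg v f]]) (simp_all add: slice_def)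

lemma inf_p_slice_eq_0:
  assumes v: "0 \<le> v"
  shows "inf (p n) (slice n v) = 0"
  using band_part_le[OF dedekind p_nonneg v] slice_nonneg[OF v]
  by (intro inf_eq_0_mono[OF inf_diff_band_part_eq_0[OF dedekind p_nonneg v]])
    (simp_all add: slice_def)

lemma slice_disjoint:
  assumes "0 \<le> v" "0 \<le> w" "m < n"
  shows "inf (slice m v) (slice n w) = 0"
proof -
  have "inf (slice n w) (p (Suc m)) = 0"
    by (rule inf_eq_0_mono[of _ "p n"])
      (use inf_p_slice_eq_0[OF assms(2)] p_mono[of "Suc m" n] p_nonneg assms(3)
        in \<open>simp_all add: inf.commute\<close>)
  from inf_slice_eq_0[OF assms(1) this] show ?thesis by (simp add: inf.commute)
qed

text \<open>\<open>slice n v\<close> lies below \<open>w\<close>, and \<open>w\<close> is the sum of its own slice and two parts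
  from which \<open>slice n v\<close> is disjoint: the part in the band of \<open>p n\<close> and the part outside
  the band of \<open>p (Suc n)\<close>.\<close>

lemma slice_mono:
  assumes v: "0 \<le> v" and "v \<le> w"
  shows "slice n v \<le> slice n w"
proof -
  have w: "0 \<le> w" using assms by simp
  have "inf (slice n v) (band_part (p n) w) = 0"
    using inf_p_slice_eq_0[OF v] by (intro inf_band_part_eq_0[OF dedekind p_nonneg w])
      (simp add: inf.commute)
  moreover have "inf (slice n v) (w - band_part (p (Suc n)) w) = 0"
    using inf_diff_band_part_eq_0[OF dedekind p_nonneg w]
    by (subst inf.commute) (intro inf_slice_eq_0[OF v], simp add: inf.commute)
  ultimately have "inf (slice n v) (band_part (p n) w + (w - band_part (p (Suc n)) w)) = 0"
    by (rule inf_add_eq_0)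
  moreover have "slice n v \<le> slice n w + (band_part (p n) w + (w - band_part (p (Suc n)) w))"
  proof -
    have "slice n v \<le> v"
      using band_part_le[OF dedekind p_nonneg v] band_part_nonneg[OF dedekind p_nonneg v]
      unfolding slice_def by (simp add: diff_le_eq add_increasing2)
    then show ?thesis using \<open>v \<le> w\<close> unfolding slice_def by simp
  qed
  ultimately show ?thesis using le_of_le_add_disjoint[OF _ _ slice_nonneg[OF w]] by blast
qed

text \<open>Slices with different indices are disjoint, whatever elements they are taken of, so choosing
  one for each index gives a disjoint sequence, and lateral completeness provides its supremum.\<close>

lemma slices_bounded:
  assumes lat: "sigma_laterally_complete TYPE('a)" and w: "\<And>n. 0 \<le> w n"
  obtains d where "0 \<le> d" "\<And>n. slice n (w n) \<le> d"
proof -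
  have "inf \<bar>slice m (w m)\<bar> \<bar>slice n (w n)\<bar> = 0" if "m \<noteq> n" for m n
    using slice_disjoint[OF w w, of m n] slice_disjoint[OF w w, of n m] slice_nonneg[OF w] that
    by (cases "m < n") (auto simp: inf.commute abs_of_nonneg)
  then have "\<exists>d. isLub UNIV (range (\<lambda>n. slice n (w n))) d"
    using lat unfolding sigma_laterally_complete_def by simp
  then obtain d where "isLub UNIV (range (\<lambda>n. slice n (w n))) d" ..
  then have d: "slice n (w n) \<le> d" for n unfolding isLub_UNIV_iff by blast
  moreover have "0 \<le> d" using d[of 0] slice_nonneg[OF w, of 0 0] by simp
  ultimately show thesis using that by blast
qed

text \<open>By induction: on the band of \<open>p (Suc n)\<close>, the element \<open>v\<close> is the sum of a slice, which
  does not exceed \<open>d\<close>, and of its part in the band of \<open>p n\<close>, from which the excess over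
  \<open>d\<close> is disjoint by induction hypothesis.\<close>

lemma excess_disjoint:
  assumes v: "0 \<le> v" and d: "\<And>n. slice n v \<le> d"
  shows "inf (sup (v - d) 0) (p n) = 0"
proof (induction n)
  case 0
  then show ?case by (simp add: p_0 inf.absorb2)
next
  case (Suc n)
  define f where "f = sup (v - d) 0"
  note bp = dedekind p_nonneg v
  let ?v1 = "band_part (p n) v" and ?v3 = "v - band_part (p (Suc n)) v"
  have f0: "0 \<le> f" unfolding f_def by simp
  have v1: "0 \<le> ?v1" and v3: "0 \<le> ?v3" using band_part_nonneg[OF bp] band_part_le[OF bp] by auto
  have "v - d \<le> ?v1 + ?v3" using d[of n] unfolding slice_def by (simp add: algebra_simps)
  then have "f \<le> ?v1 + ?v3" using v1 v3 unfolding f_def by simp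
  then have "inf f (p (Suc n)) \<le> ?v1 + ?v3" by (rule le_infI1)
  moreover have "inf (inf f (p (Suc n))) ?v3 = 0"
    using inf_diff_band_part_eq_0[OF bp, of "Suc n"] f0 p_nonneg
    by (metis inf.absorb2 inf.assoc)
  ultimately have "inf f (p (Suc n)) \<le> ?v1" using v1 by (rule le_of_le_add_disjoint)
  moreover have "inf f ?v1 = 0"
    using inf_band_part_eq_0[OF bp] Suc unfolding f_def by blast
  ultimately have "inf f (p (Suc n)) \<le> 0" by (metis inf.cobounded1 le_infI)
  moreover have "0 \<le> inf f (p (Suc n))" using f0 p_nonneg by simp
  ultimately show ?case unfolding f_def by (rule antisym)
qed

end

section \<open>Unbounded order null sequences\<close>

text \<open>In general the \<open>x n\<close> have no upper bound, so \<open>e\<close> cannot be their supremum. It is enough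
  that \<open>e\<close> dominates, for each \<open>n\<close>, the part of the partial sum that is new at stage \<open>n\<close>:
  what is disjoint from these new parts is disjoint from all partial sums.\<close>

lemma common_support:
  fixes x :: "nat \<Rightarrow> 'a::riesz_space"
  assumes dc: "sigma_dedekind_complete TYPE('a)" and lat: "sigma_laterally_complete TYPE('a)"
    and x: "\<And>n. 0 \<le> x n"
  obtains e where "0 \<le> e" "\<And>f n. inf f e = 0 \<Longrightarrow> inf f (x n) = 0"
proof -
  define s where "s n = (\<Sum>i<n. x i)" for n
  have s_mono: "m \<le> n \<Longrightarrow> s m \<le> s n" for m n
    unfolding s_def using x by (intro sum_mono2) auto
  interpret increasing_sequence s
    by unfold_locales (use dc s_mono in \<open>auto simp: s_def\<close>)
  obtain e where e: "0 \<le> e" "\<And>n. slice n (s (Suc n)) \<le> e"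
    using slices_bounded[OF lat, of "\<lambda>n. s (Suc n)"] p_nonneg by blast
  have "inf f (x n) = 0" if f: "inf f e = 0" for f n
  proof -
    have f0: "0 \<le> f" using f by (metis inf.cobounded1)
    have "inf f (s n) = 0" for n
    proof (induction n)
      case 0
      then show ?case using f0 by (simp add: s_def inf.absorb2)
    next
      case (Suc n)
      note bp = dc p_nonneg p_nonneg
      (* A positive element is equal to its own band part. *)
      have *: "s (Suc n) - band_part (s (Suc n)) (s (Suc n)) = 0"
        using inf_diff_band_part_eq_0[OF bp, of "Suc n" "Suc n"]
          band_part_nonneg[OF bp, of "Suc n" "Suc n"]
        by (simp add: inf.absorb2)
      have "inf f (band_part (s n) (s (Suc n)) + slice n (s (Suc n))) = 0"
        using inf_band_part_eq_0[OF bp Suc] inf_eq_0_mono[OF f slice_nonneg[OF p_nonneg] e(2)]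
        by (intro inf_add_eq_0) auto
      then show ?case using * unfolding slice_def by simp
    qed
    from inf_eq_0_mono[OF this[of "Suc n"] x, of n] show ?thesis
      using x by (simp add: s_def sum_nonneg)
  qed
  with e(1) show thesis using that by blast
qed

text \<open>The bound is \<open>d + e\<close>, where \<open>e\<close> covers the supports of all \<open>x n\<close> and \<open>d\<close>
  bounds all excesses \<open>a n = (\<bar>x n\<bar> - e)\<^sup>+\<close>. The upper envelopes
  \<open>z N = sup {\<bar>x n\<bar> \<and> e | n \<ge> N}\<close> decrease to zero because \<open>x\<close> is
  \<open>uo\<close>-null.\<close>

lemma uo_null_bounded:
  fixes x :: "nat \<Rightarrow> 'a::riesz_space"
  assumes dc: "sigma_dedekind_complete TYPE('a)" and lat: "sigma_laterally_complete TYPE('a)"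
    and uo: "uo_convergent UNIV nat_le x 0"
  obtains u where "0 \<le> u" "\<And>n. \<bar>x n\<bar> \<le> u"
proof -
  obtain e where e: "0 \<le> e" "\<And>f n. inf f e = 0 \<Longrightarrow> inf f \<bar>x n\<bar> = 0"
    using common_support[OF dc lat, of "\<lambda>n. \<bar>x n\<bar>"] by auto
  have "\<exists>s. isLub UNIV (range (\<lambda>k. inf \<bar>x (N + k)\<bar> e)) s" for N
    by (rule isLub_sequence[OF dc, of _ e]) simp
  then obtain z where z: "isLub UNIV (range (\<lambda>k. inf \<bar>x (N + k)\<bar> e)) (z N)" for N by metis
  have z_ub: "inf \<bar>x n\<bar> e \<le> z N" if "N \<le> n" for n N
    using z[of N] that unfolding isLub_UNIV_iff by (metis le_iff_add rangeI)
  have z_least: "z N \<le> t" if "\<And>n. N \<le> n \<Longrightarrow> inf \<bar>x n\<bar> e \<le> t" for t N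
    using z[of N] that unfolding isLub_UNIV_iff by auto
  have z_le: "z N \<le> e" for N by (rule z_least) simp
  have z_anti: "z n \<le> z m" if "m \<le> n" for m n
    using that by (intro z_least z_ub) simp
  have z_inf: "t \<le> 0" if t: "\<And>N. t \<le> z N" for t
  proof -
    obtain B s y where y: "decreases_to_zero (B :: 'a set) s y"
      and xy: "\<And>b. b \<in> B \<Longrightarrow> \<exists>N. \<forall>n. N \<le> n \<longrightarrow> inf \<bar>x n\<bar> e \<le> y b"
      using uo e(1) unfolding uo_convergent_def order_convergent_def
      by (auto simp: abs_of_nonneg)
    have "t \<le> y b" if "b \<in> B" for b
      using xy[OF that] z_least t by (meson order_trans)
    then show ?thesis using y unfolding decreases_to_zero_iff by blast
  qed
  (* Prepending 0 makes the first slice the whole part in the band of e - z 0. *)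
  define p where "p n = (case n of 0 \<Rightarrow> 0 | Suc N \<Rightarrow> e - z N)" for n
  interpret increasing_sequence p
  proof
    show "p m \<le> p n" if "m \<le> n" for m n
      using that z_le z_anti by (auto simp: p_def split: nat.split)
  qed (use dc in \<open>simp_all add: p_def\<close>)
  define a where "a n = sup (\<bar>x n\<bar> - e) 0" for n
  have a0: "0 \<le> a n" for n unfolding a_def by simp
  (* For n >= N, p (Suc N) is below e - inf |x n| e, which is the negative part of |x n| - e,
     while a n is the positive part. *)
  have a_p: "inf (a n) (p (Suc N)) = 0" if "N \<le> n" for n N
  proof (rule inf_eq_0_mono[OF _ p_nonneg])
    define k where "k = inf (\<bar>x n\<bar> - e) 0"
    have "\<bar>x n\<bar> - e = a n + k"
      using add_eq_inf_sup[of "\<bar>x n\<bar> - e" 0] unfolding a_def k_def by simp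
    then have "inf (a n) (- k) = 0"
      using add_inf_distrib_right[of "\<bar>x n\<bar> - e" 0 "- k"] unfolding k_def[symmetric] by simp
    moreover have "e - inf \<bar>x n\<bar> e = - k"
      using add_inf_distrib_right[of "\<bar>x n\<bar>" e "- e"] unfolding k_def by (simp add: algebra_simps)
    ultimately show "inf (a n) (e - inf \<bar>x n\<bar> e) = 0" by simp
    show "p (Suc N) \<le> e - inf \<bar>x n\<bar> e" using diff_left_mono[OF z_ub[OF that], of e] by (simp add: p_def del: diff_inf_eq_sup)
  qed
  (* Only a i with i <= N can have a nonzero slice at N, so their sum dominates all of them there. *)
  obtain d where d: "0 \<le> d" "\<And>N. slice N (\<Sum>i\<le>N. a i) \<le> d"
    using slices_bounded[OF lat, of "\<lambda>N. \<Sum>i\<le>N. a i"] a0 by (metis sum_nonneg)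
  have "a n \<le> d" for n
  proof -
    have "slice N (a n) \<le> d" for N
    proof (cases "n \<le> N")
      case True
      then have "a n \<le> (\<Sum>i\<le>N. a i)" using sum_mono2[of "{..N}" "{n}" a] a0 by simp
      from slice_mono[OF a0 this] d(2) show ?thesis using order_trans by blast
    next
      case False
      then have "inf (a n) (slice N (a n)) = 0" by (intro inf_slice_eq_0 a0 a_p) simp
      moreover have "slice N (a n) \<le> a n"
        using band_part_le[OF dedekind p_nonneg a0] band_part_nonneg[OF dedekind p_nonneg a0]
        unfolding slice_def by (simp add: diff_le_eq add_increasing2)
      ultimately have "slice N (a n) = 0" by (simp add: inf.absorb2)
      then show ?thesis using d(1) by simp
    qed
    note f_p = excess_disjoint[OF a0 this]
    (* The excess f of a n over d is disjoint from e - z N, so inf f e <= z N for all N. As the z N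
       decrease to zero, f is disjoint from e, hence from x n, although f <= |x n|. *)
    define f where "f = sup (a n - d) 0"
    have f0: "0 \<le> f" and f_le: "f \<le> a n" "a n \<le> \<bar>x n\<bar>"
      using d(1) e(1) a0 unfolding f_def a_def by auto
    have "inf f e \<le> z N" for N
    proof -
      have "inf f e \<le> inf f (p (Suc N)) + inf f (z N)"
        using inf_add_le[OF f0 p_nonneg[of "Suc N"], of "z N"] z_ub[of N N] e(1)
        by (simp add: p_def) (meson abs_ge_zero le_infI order_trans)
      then show ?thesis using f_p[of "Suc N"] unfolding f_def by (simp add: le_infI2)
    qed
    from z_inf[OF this] have "inf f e = 0" using f0 e(1) by (intro antisym) auto
    then have "inf f \<bar>x n\<bar> = 0" by (rule e(2))
    then have "f = 0" using f_le by (metis inf.absorb1 order_trans)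
    then show ?thesis unfolding f_def by (metis diff_le_0_iff_le sup.cobounded1)
  qed
  then have "\<bar>x n\<bar> - e \<le> d" for n unfolding a_def by (meson sup.cobounded1 order_trans)
  then show thesis using that[of "d + e"] d(1) e(1) by (simp add: diff_le_eq)
qed

lemma uo_null_imp_order_null:
  fixes x :: "nat \<Rightarrow> 'a::riesz_space"
  assumes "sigma_dedekind_complete TYPE('a)" "sigma_laterally_complete TYPE('a)"
    and uo: "uo_convergent UNIV nat_le x 0"
  shows "order_convergent UNIV nat_le x 0"
proof -
  obtain u where u: "0 \<le> u" "\<And>n. \<bar>x n\<bar> \<le> u" using uo_null_bounded[OF assms] by blast
  then have "order_convergent UNIV nat_le (\<lambda>n. inf \<bar>x n\<bar> u) 0"
    using uo unfolding uo_convergent_def by simp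
  then show ?thesis by (rule order_convergent_dominated) (simp add: u inf.absorb1)
qed

theorem proposition2:
  shows
    "(\<forall>T \<in> (L_so :: ('e::riesz_space \<Rightarrow> 'f::riesz_space) set).
        \<forall>S \<in> (L_n :: ('f \<Rightarrow> 'g::riesz_space) set). S \<circ> T \<in> L_so) \<and>
     left_ideal (L_so :: ('e \<Rightarrow> 'e) set) L_n \<and>
     left_ideal (L_s_sigma_o :: ('e \<Rightarrow> 'e) set) L_c \<and>
     (sigma_dedekind_complete TYPE('e) \<and> sigma_laterally_complete TYPE('e) \<longrightarrow>
        (\<forall>S \<in> (L_c :: ('e \<Rightarrow> 'f) set).
           \<forall>T \<in> (L_s_sigma_o :: ('f \<Rightarrow> 'g) set). T \<circ> S \<in> L_s_sigma_o) \<and>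
        (L_s_sigma_o :: ('e \<Rightarrow> 'f) set) = L_c)"
proof (intro conjI ballI impI)
  show "S \<circ> T \<in> L_so" if "T \<in> L_so" "S \<in> L_n" for T :: "'e \<Rightarrow> 'f" and S :: "'f \<Rightarrow> 'g"
    using L_n_comp_L_so that by blast
  show "left_ideal (L_so :: ('e \<Rightarrow> 'e) set) L_n"
    unfolding left_ideal_def operator_algebra_def
    using operator_subspace_L_n operator_subspace_L_so L_so_subset_L_n L_n_comp L_n_comp_L_so
    by blast
  show "left_ideal (L_s_sigma_o :: ('e \<Rightarrow> 'e) set) L_c"
    unfolding left_ideal_def operator_algebra_def
    using operator_subspace_L_c operator_subspace_L_s_sigma_o L_s_sigma_o_subset_L_c L_c_comp
      L_c_comp_L_s_sigma_o by blast
  assume E: "sigma_dedekind_complete TYPE('e) \<and> sigma_laterally_complete TYPE('e)"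
  have L_c_subset: "L_c \<subseteq> (L_s_sigma_o :: ('e \<Rightarrow> 'h::riesz_space) set)"
    unfolding L_s_sigma_o_def L_c_def s_sigma_o_continuous_def sigma_order_continuous_def
    using uo_null_imp_order_null E by blast
  then show "(L_s_sigma_o :: ('e \<Rightarrow> 'f) set) = L_c" using L_s_sigma_o_subset_L_c by blast
  show "T \<circ> S \<in> L_s_sigma_o" if "S \<in> L_c" "T \<in> L_s_sigma_o" for S :: "'e \<Rightarrow> 'f" and T :: "'f \<Rightarrow> 'g"
    using L_c_comp[of T S] L_s_sigma_o_subset_L_c L_c_subset that by blast
qed

end
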